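(* Let $q\in\mathbb{N}$, let $T$ be a $(q+1)$-homogeneous tree rooted at $o$ and let $1\le p\le\infty$. Then every bounded self map $\phi$ of $T$ induces a compact composition operator $C_\phi$ on $\mathbb{T}_p$.
   Context: $\mathbb{N}=\{1,2,\ldots\}$, $\mathbb{N}_0=\mathbb{N}\cup\{0\}$. A $(q+1)$-homogeneous tree is an (infinite) connected graph without cycles in which every vertex has exactly $q+1$ neighbours; it is rooted at a fixed vertex $o$. We identify $T$ with its vertex set, and $|v|$ denotes the number of edges in the unique path from $o$ to $v$. A self map of $T$ is an arbitrary function $\phi:T\to T$ on vertices; it is called bounded if $\sup\{|\phi(v)| : v\in T\}<\infty$. For $f:T\to\mathbb{C}$ put $M_p(0,f)=|f(o)|$ and, for $n\in\mathbb{N}$, $M_p(n,f)=\left(\frac{1}{(q+1)q^{n-1}}\sum_{|v|=n}|f(v)|^p\right)^{1/p}$ if $p<\infty$ and $M_\infty(n,f)=\max_{|v|=n}|f(v)|$. Let $\|f\|_p=\sup_{n\in\mathbb{N}_0}M_p(n,f)$ and $\mathbb{T}_p=\{f:T\to\mathbb{C} : \|f\|_p<\infty\}$, a Banach space under $\|\cdot\|_p$. The composition operator is $C_\phi f=f\circ\phi$. $C_\phi$ is compact on $\mathbb{T}_p$ if it is a bounded linear operator from $\mathbb{T}_p$ to itself and the image $\{C_\phi f : \|f\|_p\le 1\}$ of the closed unit ball has compact closure in $\mathbb{T}_p$. *)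

theory Defs
  imports "HOL-Analysis.Analysis"
begin

text \<open>A simple graph is given by its adjacency relation; its vertices are all elements of the
  type \<open>'v\<close>. A path is represented by its nonempty list of pairwise distinct vertices.\<close>

definition graph_path :: "('v \<Rightarrow> 'v \<Rightarrow> bool) \<Rightarrow> 'v \<Rightarrow> 'v list \<Rightarrow> 'v \<Rightarrow> bool" where
  "graph_path adj u xs v \<longleftrightarrow>
     xs \<noteq> [] \<and> hd xs = u \<and> last xs = v \<and> distinct xs \<and> successively adj xs"

definition graph_connected :: "('v \<Rightarrow> 'v \<Rightarrow> bool) \<Rightarrow> bool" where
  "graph_connected adj \<longleftrightarrow> (\<forall>u v. \<exists>xs. graph_path adj u xs v)"

text \<open>The closing edge of a cycle joins the last vertex of the list to the first; the length
  condition excludes traversing a single edge back and forth.\<close>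

definition graph_cycle :: "('v \<Rightarrow> 'v \<Rightarrow> bool) \<Rightarrow> 'v list \<Rightarrow> bool" where
  "graph_cycle adj xs \<longleftrightarrow>
     length xs \<ge> 3 \<and> distinct xs \<and> successively adj xs \<and> adj (last xs) (hd xs)"

definition homogeneous_tree :: "nat \<Rightarrow> ('v \<Rightarrow> 'v \<Rightarrow> bool) \<Rightarrow> bool" where
  "homogeneous_tree d adj \<longleftrightarrow>
     symp adj \<and> irreflp adj \<and>
     graph_connected adj \<and> (\<nexists>xs. graph_cycle adj xs) \<and>
     (\<forall>v. finite {w. adj v w} \<and> card {w. adj v w} = d)"

text \<open>A path with \<open>k\<close> edges is a list of \<open>k + 1\<close> vertices.\<close>

definition tree_level :: "('v \<Rightarrow> 'v \<Rightarrow> bool) \<Rightarrow> 'v \<Rightarrow> 'v \<Rightarrow> nat" where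
  "tree_level adj r v = length (THE xs. graph_path adj r xs v) - 1"

definition tree_sphere :: "('v \<Rightarrow> 'v \<Rightarrow> bool) \<Rightarrow> 'v \<Rightarrow> nat \<Rightarrow> 'v set" where
  "tree_sphere adj r n = {v. tree_level adj r v = n}"

definition bounded_self_map :: "('v \<Rightarrow> 'v \<Rightarrow> bool) \<Rightarrow> 'v \<Rightarrow> ('v \<Rightarrow> 'v) \<Rightarrow> bool" where
  "bounded_self_map adj r \<phi> \<longleftrightarrow> bdd_above (range (\<lambda>v. tree_level adj r (\<phi> v)))"

text \<open>The exponent \<open>p \<in> [1, \<infinity>]\<close> is an extended nonnegative real.\<close>

definition tree_mean ::
  "nat \<Rightarrow> ('v \<Rightarrow> 'v \<Rightarrow> bool) \<Rightarrow> 'v \<Rightarrow> ennreal \<Rightarrow> nat \<Rightarrow> ('v \<Rightarrow> complex) \<Rightarrow> real" where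
  "tree_mean q adj r p n f =
     (if n = 0 then cmod (f r)
      else if p = \<infinity> then Max ((\<lambda>v. cmod (f v)) ` tree_sphere adj r n)
      else (1 / (real (q + 1) * real q ^ (n - 1))
              * (\<Sum>v\<in>tree_sphere adj r n. cmod (f v) powr enn2real p)) powr (1 / enn2real p))"

definition hardy_norm ::
  "nat \<Rightarrow> ('v \<Rightarrow> 'v \<Rightarrow> bool) \<Rightarrow> 'v \<Rightarrow> ennreal \<Rightarrow> ('v \<Rightarrow> complex) \<Rightarrow> ennreal" where
  "hardy_norm q adj r p f = (SUP n. ennreal (tree_mean q adj r p n f))"

definition hardy_space ::
  "nat \<Rightarrow> ('v \<Rightarrow> 'v \<Rightarrow> bool) \<Rightarrow> 'v \<Rightarrow> ennreal \<Rightarrow> ('v \<Rightarrow> complex) set" where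
  "hardy_space q adj r p = {f. hardy_norm q adj r p f < \<infinity>}"

definition composition_op :: "('v \<Rightarrow> 'v) \<Rightarrow> ('v \<Rightarrow> complex) \<Rightarrow> 'v \<Rightarrow> complex" where
  "composition_op \<phi> f = f \<circ> \<phi>"

text \<open>Operators on a space \<open>X\<close> of complex functions with pointwise operations, normed by \<open>N\<close>,
  where \<open>N\<close> takes finite values on \<open>X\<close>.\<close>

definition bounded_linear_operator_on ::
  "('v \<Rightarrow> complex) set \<Rightarrow> (('v \<Rightarrow> complex) \<Rightarrow> ennreal) \<Rightarrow> (('v \<Rightarrow> complex) \<Rightarrow> 'v \<Rightarrow> complex) \<Rightarrow> bool"
where
  "bounded_linear_operator_on X N A \<longleftrightarrow>
     A \<in> X \<rightarrow> X \<and>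
     (\<forall>f\<in>X. \<forall>g\<in>X. A (\<lambda>v. f v + g v) = (\<lambda>v. A f v + A g v)) \<and>
     (\<forall>c. \<forall>f\<in>X. A (\<lambda>v. c * f v) = (\<lambda>v. c * A f v)) \<and>
     (\<exists>K::real. \<forall>f\<in>X. N (A f) \<le> ennreal K * N f)"

definition norm_topology ::
  "('v \<Rightarrow> complex) set \<Rightarrow> (('v \<Rightarrow> complex) \<Rightarrow> ennreal) \<Rightarrow> ('v \<Rightarrow> complex) topology" where
  "norm_topology X N = Metric_space.mtopology X (\<lambda>f g. enn2real (N (\<lambda>v. f v - g v)))"

definition compact_operator_on ::
  "('v \<Rightarrow> complex) set \<Rightarrow> (('v \<Rightarrow> complex) \<Rightarrow> ennreal) \<Rightarrow> (('v \<Rightarrow> complex) \<Rightarrow> 'v \<Rightarrow> complex) \<Rightarrow> bool"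
where
  "compact_operator_on X N A \<longleftrightarrow>
     bounded_linear_operator_on X N A \<and>
     compactin (norm_topology X N) (norm_topology X N closure_of (A ` {f \<in> X. N f \<le> 1}))"

end

theory Submission
  imports Defs
begin

text \<open>Each ball of the tree is finite, and each point evaluation is controlled by the mean on its
  sphere, hence by the norm. If \<open>\<phi>\<close> has its range in the finite ball \<open>B\<close>, then \<open>f \<circ> \<phi>\<close> depends only
  on the restriction of \<open>f\<close> to \<open>B\<close>. This restriction ranges over a compact polydisc when \<open>f\<close> ranges
  over the unit ball, and the sphere means of \<open>f \<circ> \<phi>\<close> are at most the maximum of \<open>\<bar>f\<bar>\<close> over \<open>B\<close>.
  So the image of the unit ball lies in a continuous image of a compact polydisc.\<close>

section \<open>Minkowski's inequality for weighted finite sums\<close>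

text \<open>For positive \<open>x\<close> and \<open>y\<close> this is convexity of the power
  function. If one of them is 0, it reduces to \<open>s powr P \<le> s\<close> for \<open>s\<close>
  in [0, 1].\<close>

lemma powr_convex_combination:
  fixes x y t P :: real
  assumes "1 \<le> P" "0 \<le> x" "0 \<le> y" "0 \<le> t" "t \<le> 1"
  shows "((1 - t) * x + t * y) powr P \<le> (1 - t) * x powr P + t * y powr P"
proof -
  have le: "s powr P \<le> s" if "0 \<le> s" "s \<le> 1" for s :: real
    using powr_mono'[of 1 P s] that assms(1) by auto
  have scale: "(s * z) powr P \<le> s * z powr P" if "0 \<le> s" "s \<le> 1" for s z :: real
    using le[OF that] by (simp add: powr_mult mult_right_mono)
  consider "x = 0" | "y = 0" | "x > 0" "y > 0"
    using assms by linarith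
  then show ?thesis
  proof cases
    case 1
    then show ?thesis using scale[of t y] assms by simp
  next
    case 2
    then show ?thesis using scale[of "1 - t" x] assms by simp
  next
    case 3
    then show ?thesis
      using convex_onD[OF powr_convex[OF assms(1)], of t x y] assms by simp
  qed
qed

text \<open>Let \<open>A\<close> and \<open>B\<close> be the two terms on the right. Then
  \<open>(a i + b i) / (A + B)\<close> is a convex combination of \<open>a i / A\<close> and
  \<open>b i / B\<close> with weights \<open>A / (A + B)\<close> and \<open>B / (A + B)\<close>.
  Convexity of the power, applied termwise and summed with the factor \<open>c\<close>, bounds the
  normalised sum by 1.\<close>

lemma Minkowski_inequality_sum:
  fixes a b :: "'i \<Rightarrow> real" and c P :: real
  assumes P: "1 \<le> P" and c: "0 \<le> c" and S: "finite S"
    and a: "\<And>i. i \<in> S \<Longrightarrow> 0 \<le> a i" and b: "\<And>i. i \<in> S \<Longrightarrow> 0 \<le> b i"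
  shows "(c * (\<Sum>i\<in>S. (a i + b i) powr P)) powr (1 / P)
       \<le> (c * (\<Sum>i\<in>S. a i powr P)) powr (1 / P) + (c * (\<Sum>i\<in>S. b i powr P)) powr (1 / P)"
proof -
  define A where "A = (c * (\<Sum>i\<in>S. a i powr P)) powr (1 / P)"
  define B where "B = (c * (\<Sum>i\<in>S. b i powr P)) powr (1 / P)"
  have Apow: "A powr P = c * (\<Sum>i\<in>S. a i powr P)"
    unfolding A_def using P c by (simp add: powr_powr sum_nonneg)
  have Bpow: "B powr P = c * (\<Sum>i\<in>S. b i powr P)"
    unfolding B_def using P c by (simp add: powr_powr sum_nonneg)
  have AB0: "0 \<le> A" "0 \<le> B" by (simp_all add: A_def B_def)
  \<comment> \<open>The normalisation divides by \<open>A\<close> and \<open>B\<close>. If one of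
    them is 0, then \<open>c = 0\<close> or one family vanishes on \<open>S\<close>, and the
    inequality is immediate.\<close>
  have degenerate: "c = 0 \<or> (\<forall>i\<in>S. d i = 0)"
    if "(c * (\<Sum>i\<in>S. d i powr P)) powr (1 / P) = 0" for d :: "'i \<Rightarrow> real"
    using that S P by (simp add: sum_nonneg_eq_0_iff)
  consider "c = 0" | "\<forall>i\<in>S. a i = 0" | "\<forall>i\<in>S. b i = 0" | "A > 0" "B > 0"
    using degenerate[of a] degenerate[of b] AB0 A_def B_def by fastforce
  then show ?thesis
  proof cases
    case 4
    define t where "t = B / (A + B)"
    have t: "0 \<le> t" "t \<le> 1" using 4 by (auto simp: t_def)
    have pt: "(a i + b i) powr P
        \<le> (A + B) powr P * ((1 - t) * (a i powr P / A powr P) + t * (b i powr P / B powr P))"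
      if "i \<in> S" for i
    proof -
      have "(1 - t) * (a i / A) = a i / (A + B)" "t * (b i / B) = b i / (A + B)"
        using 4 by (auto simp: t_def divide_simps)
      then have eq: "a i + b i = (A + B) * ((1 - t) * (a i / A) + t * (b i / B))"
        using 4 by (simp add: add_divide_distrib[symmetric])
      have "(a i + b i) powr P = (A + B) powr P * ((1 - t) * (a i / A) + t * (b i / B)) powr P"
        by (subst eq) (simp only: powr_mult)
      also have "\<dots> \<le> (A + B) powr P * ((1 - t) * (a i / A) powr P + t * (b i / B) powr P)"
        by (intro mult_left_mono powr_convex_combination) (use 4 a[OF that] b[OF that] P t in auto)
      finally show ?thesis by (simp only: powr_divide)
    qed
    have "c * (\<Sum>i\<in>S. (a i + b i) powr P)
        \<le> c * (\<Sum>i\<in>S. (A + B) powr P * ((1 - t) * (a i powr P / A powr P) + t * (b i powr P / B powr P)))"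
      by (intro mult_left_mono sum_mono pt c)
    also have "\<dots> = (A + B) powr P * ((1 - t) * ((c * (\<Sum>i\<in>S. a i powr P)) / A powr P)
                      + t * ((c * (\<Sum>i\<in>S. b i powr P)) / B powr P))"
      by (simp add: sum_distrib_left sum_divide_distrib sum.distrib distrib_left mult_ac)
    also have "\<dots> = (A + B) powr P"
      using 4 by (simp add: Apow[symmetric] Bpow[symmetric])
    finally have "(c * (\<Sum>i\<in>S. (a i + b i) powr P)) powr (1 / P) \<le> ((A + B) powr P) powr (1 / P)"
      by (intro powr_mono2) (use P c in \<open>auto intro!: mult_nonneg_nonneg sum_nonneg\<close>)
    also have "\<dots> = A + B" using 4 P by (simp add: powr_powr)
    finally show ?thesis by (simp add: A_def B_def)
  qed (use P in \<open>simp_all add: sum_nonneg\<close>)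
qed

section \<open>Paths and spheres in a homogeneous tree\<close>

lemma graph_path_Cons:
  "graph_path adj u (x # xs) v \<longleftrightarrow>
     x = u \<and> (xs = [] \<and> u = v \<or> (\<exists>w. adj u w \<and> u \<notin> set xs \<and> graph_path adj w xs v))"
  by (cases xs) (auto simp: graph_path_def)

lemma graph_path_snoc:
  "graph_path adj u (xs @ [y]) v \<longleftrightarrow>
     y = v \<and> (xs = [] \<and> u = v \<or> (\<exists>w. adj w v \<and> v \<notin> set xs \<and> graph_path adj u xs w))"
  by (cases "xs = []") (auto simp: graph_path_def successively_append_iff)

text \<open>If two paths leave \<open>u\<close> along different edges, then following the first up to the point
  where it meets the second and returning along the second closes a cycle.\<close>

lemma graph_path_unique:
  assumes "symp adj" and acyclic: "\<nexists>xs. graph_cycle adj xs"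
    and "graph_path adj u xs v" "graph_path adj u ys v"
  shows "xs = ys"
  using assms(3,4)
proof (induction xs arbitrary: u ys)
  case Nil
  then show ?case by (simp add: graph_path_def)
next
  case (Cons x xs)
  from Cons.prems obtain y ys' where ys: "ys = y # ys'"
    by (cases ys) (auto simp: graph_path_def)
  have xy: "x = u" "y = u" using Cons.prems ys by (auto simp: graph_path_Cons)
  show ?case
  proof (cases "u = v")
    case True
    have "zs = [v]" if "graph_path adj v zs v" for zs
      using that by (cases zs rule: rev_cases) (auto simp: graph_path_def hd_append split: if_splits)
    then show ?thesis using Cons.prems True by blast
  next
    case False
    obtain s where s: "adj u s" "u \<notin> set xs" "graph_path adj s xs v"
      using Cons.prems(1) False by (auto simp: graph_path_Cons)
    obtain t where t: "adj u t" "u \<notin> set ys'" "graph_path adj t ys' v"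
      using Cons.prems(2) False by (auto simp: graph_path_Cons ys)
    have "s = t"
    proof (rule ccontr)
      assume "s \<noteq> t"
      \<comment> \<open>Both paths end in \<open>v\<close>, so they meet. Taking the first meeting
        point along \<open>xs\<close> keeps \<open>xs1\<close> disjoint from \<open>ys1\<close>, as
        a cycle requires.\<close>
      have "\<exists>w\<in>set xs. w \<in> set ys'"
        using s(3) t(3) by (metis graph_path_def last_in_set)
      then obtain xs1 w xs2 where xs: "xs = xs1 @ w # xs2" "w \<in> set ys'"
        "\<forall>z\<in>set xs1. z \<notin> set ys'" by (rule split_list_first_propE)
      then obtain ys1 ys2 where ys': "ys' = ys1 @ w # ys2" by (meson split_list)
      have adj_rev: "successively adj ys1 \<Longrightarrow> successively adj (rev ys1)"
        using sympD[OF \<open>symp adj\<close>] by (auto elim: successively_mono)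
      have adj_last: "ys1 \<noteq> [] \<Longrightarrow> adj w (hd (rev ys1))"
        using t(3) sympD[OF \<open>symp adj\<close>]
        by (auto simp: graph_path_def ys' successively_append_iff hd_rev)
      have "graph_cycle adj (u # xs1 @ w # rev ys1)"
        unfolding graph_cycle_def
      proof (intro conjI)
        \<comment> \<open>If \<open>xs1\<close> and \<open>ys1\<close> were both empty,
          \<open>w\<close> would equal both \<open>s\<close> and \<open>t\<close>.\<close>
        show "3 \<le> length (u # xs1 @ w # rev ys1)"
          using \<open>s \<noteq> t\<close> s(3) t(3) by (cases xs1; cases ys1) (auto simp: graph_path_def xs ys')
        show "distinct (u # xs1 @ w # rev ys1)"
          using s t xs by (auto simp: graph_path_def ys')
        show "successively adj (u # xs1 @ w # rev ys1)"
          using s t adj_last adj_rev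
          by (auto simp: graph_path_def xs ys' successively_Cons successively_append_iff
              hd_append simp del: successively_rev split: if_splits)
        show "adj (last (u # xs1 @ w # rev ys1)) (hd (u # xs1 @ w # rev ys1))"
          using t(1,3) sympD[OF \<open>symp adj\<close>]
          by (auto simp: graph_path_def ys' last_rev hd_append split: if_splits)
      qed
      then show False using acyclic by blast
    qed
    then show ?thesis using Cons.IH s t xy ys by blast
  qed
qed

locale rooted_homogeneous_tree =
  fixes q :: nat and adj :: "'v \<Rightarrow> 'v \<Rightarrow> bool" and r :: 'v
  assumes q: "q \<ge> 1" and tree: "homogeneous_tree (q + 1) adj"
begin

abbreviation "level \<equiv> tree_level adj r"
abbreviation "shell \<equiv> tree_sphere adj r"

lemma adj_sym: "adj u v \<Longrightarrow> adj v u"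
  using tree by (auto simp: homogeneous_tree_def symp_def)

lemma adj_irrefl: "\<not> adj v v"
  using tree by (auto simp: homogeneous_tree_def irreflp_def)

lemma acyclic: "\<not> graph_cycle adj xs"
  using tree by (auto simp: homogeneous_tree_def)

lemma finite_neighbours: "finite {w. adj v w}" and card_neighbours: "card {w. adj v w} = q + 1"
  using tree by (auto simp: homogeneous_tree_def)

text \<open>Uniqueness of paths makes the definite description in \<open>tree_level\<close> denote
  whichever path is at hand.\<close>

lemma level_eq:
  assumes "graph_path adj r xs v"
  shows "level v = length xs - 1"
proof -
  have "(THE ys. graph_path adj r ys v) = xs"
    using graph_path_unique tree assms by (intro the_equality) (auto simp: homogeneous_tree_def)
  then show ?thesis by (simp add: tree_level_def)
qed

lemma obtain_path:
  obtains xs where "graph_path adj r xs v" "length xs = Suc (level v)"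
proof -
  obtain xs where "graph_path adj r xs v"
    using tree unfolding homogeneous_tree_def graph_connected_def by blast
  moreover have "xs \<noteq> []" using calculation by (auto simp: graph_path_def)
  ultimately show ?thesis using that[of xs] level_eq[of xs v] by (cases xs) auto
qed

lemma level_eq_0_iff: "level v = 0 \<longleftrightarrow> v = r"
proof
  obtain xs where xs: "graph_path adj r xs v" "length xs = Suc (level v)" by (rule obtain_path)
  assume "level v = 0"
  then show "v = r" using xs by (auto simp: graph_path_def length_Suc_conv)
next
  have "graph_path adj r [r] r" by (simp add: graph_path_def)
  from level_eq[OF this] show "level v = 0" if "v = r" using that by simp
qed

text \<open>Otherwise at least two vertices follow \<open>w\<close> on the path, and the segment
  from \<open>w\<close> to \<open>v\<close> is closed to a cycle by the edge between
  \<open>v\<close> and \<open>w\<close>.\<close>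

lemma neighbour_on_path:
  assumes xs: "graph_path adj r xs v" and w: "adj v w" "w \<in> set xs"
  shows "w = last (butlast xs)"
proof -
  obtain ys zs where yz: "xs = ys @ w # zs" using w(2) by (meson split_list)
  have "zs \<noteq> []" using xs w(1) adj_irrefl by (auto simp: graph_path_def yz)
  moreover have "\<not> length zs \<ge> 2"
  proof
    assume "length zs \<ge> 2"
    then have "graph_cycle adj (w # zs)"
      using xs w(1) by (auto simp: graph_cycle_def graph_path_def yz successively_append_iff split: if_splits)
    then show False using acyclic by blast
  qed
  ultimately obtain z where "zs = [z]"
    by (cases zs; cases "tl zs") auto
  then show ?thesis by (simp add: yz butlast_append)
qed

section \<open>Children of a vertex and the size of spheres\<close>

abbreviation children :: "'v \<Rightarrow> 'v set" where
  "children v \<equiv> {w. adj v w \<and> level w = Suc (level v)}"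

text \<open>Deleting the last vertex of the path to \<open>v\<close> leaves the path to the
  parent.\<close>

lemma obtain_parent:
  assumes "level v = Suc n"
  obtains u where "level u = n" "v \<in> children u"
proof -
  obtain xs where xs: "graph_path adj r xs v" "length xs = Suc (Suc n)"
    using obtain_path assms by metis
  obtain zs y where zs: "xs = zs @ [y]" using xs(2) by (cases xs rule: rev_cases) auto
  obtain u where u: "adj u v" "graph_path adj r zs u"
    using xs zs by (auto simp: graph_path_snoc)
  have "level u = n" using level_eq[OF u(2)] xs(2) zs by simp
  then show ?thesis using that u assms by simp
qed

lemma finite_children: "finite (children v)"
  by (rule finite_subset[OF _ finite_neighbours[of v]]) auto

text \<open>Away from the root, one of the \<open>q + 1\<close> neighbours is the parent, whose
  level is too small for a child.\<close>

lemma card_children_le: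
  "card (children v) \<le> (if v = r then q + 1 else q)"
proof (cases "v = r")
  case True
  have "card (children v) \<le> card {w. adj v w}"
    by (intro card_mono finite_neighbours) auto
  then show ?thesis using True card_neighbours by simp
next
  case False
  then obtain n where n: "level v = Suc n" using level_eq_0_iff not0_implies_Suc by blast
  then obtain u where u: "level u = n" "v \<in> children u" by (rule obtain_parent)
  have "card (children v) \<le> card ({w. adj v w} - {u})"
    by (intro card_mono finite_Diff finite_neighbours) (use n u in auto)
  also have "\<dots> = q"
    using u adj_sym card_neighbours[of v] finite_neighbours[of v] by (subst card_Diff_singleton) auto
  finally show ?thesis using False by simp
qed

text \<open>A neighbour off the path to \<open>v\<close> extends that path and is therefore a child.
  At most one neighbour lies on the path, while \<open>v\<close> has \<open>q + 1 \<ge> 2\<close> of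
  them.\<close>

lemma children_nonempty: "children v \<noteq> {}"
proof
  assume empty: "children v = {}"
  obtain xs where xs: "graph_path adj r xs v" "length xs = Suc (level v)" by (rule obtain_path)
  \<comment> \<open>For \<open>v = r\<close> the right-hand side is \<open>last []\<close>, an
    unspecified vertex; the count below only asks for a set with one element.\<close>
  have "w = last (butlast xs)" if "adj v w" for w
  proof (rule ccontr)
    assume "w \<noteq> last (butlast xs)"
    then have "w \<notin> set xs" using neighbour_on_path xs(1) that by blast
    then have "graph_path adj r (xs @ [w]) w"
      using that xs(1) by (auto simp: graph_path_snoc)
    from level_eq[OF this] have "w \<in> children v" using that xs(2) by simp
    then show False using empty by blast
  qed
  then have "{w. adj v w} \<subseteq> {last (butlast xs)}" by blast
  from card_mono[OF _ this] show False using card_neighbours[of v] q by simp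
qed

lemma shell_0: "shell 0 = {r}"
  by (auto simp: tree_sphere_def level_eq_0_iff)

lemma shell_Suc: "shell (Suc n) = (\<Union>v\<in>shell n. children v)"
  by (auto simp: tree_sphere_def elim: obtain_parent)

lemma finite_shell: "finite (shell n)"
  by (induction n) (auto simp: shell_0 shell_Suc finite_children)

text \<open>This gives \<open>Max\<close> over a sphere its intended meaning in the case
  \<open>p = \<infinity>\<close>.\<close>

lemma shell_nonempty: "shell n \<noteq> {}"
proof (induction n)
  case (Suc n)
  then show ?case using children_nonempty by (auto simp: shell_Suc)
qed (simp add: shell_0)

text \<open>The root has at most \<open>q + 1\<close> children and every later vertex at most
  \<open>q\<close>. The bound is the normalising factor of \<open>tree_mean\<close>, so the weights
  on a sphere sum to at most 1.\<close>

lemma card_shell_Suc_le: "card (shell (Suc n)) \<le> (q + 1) * q ^ n"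
proof (induction n)
  case 0
  then show ?case using card_children_le[of r] by (simp add: shell_Suc[of 0] shell_0)
next
  case (Suc n)
  have "r \<notin> shell (Suc n)" by (simp add: tree_sphere_def level_eq_0_iff[THEN iffD2])
  then have "card (children v) \<le> q" if "v \<in> shell (Suc n)" for v
    using that card_children_le[of v] by (auto split: if_splits)
  then have "(\<Sum>v\<in>shell (Suc n). card (children v)) \<le> card (shell (Suc n)) * q"
    using sum_bounded_above[of "shell (Suc n)" "\<lambda>v. card (children v)" q] by simp
  moreover have "card (shell (Suc (Suc n))) \<le> (\<Sum>v\<in>shell (Suc n). card (children v))"
    unfolding shell_Suc[of "Suc n"] by (rule card_UN_le[OF finite_shell])
  ultimately have "card (shell (Suc (Suc n))) \<le> card (shell (Suc n)) * q" by linarith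
  also have "\<dots> \<le> (q + 1) * q ^ n * q" using Suc.IH by (rule mult_right_mono) simp
  finally show ?case by (simp add: mult_ac)
qed

lemma finite_ball: "finite {v. level v \<le> m}"
proof -
  have "{v. level v \<le> m} = (\<Union>n\<le>m. shell n)" by (auto simp: tree_sphere_def)
  then show ?thesis by (simp add: finite_shell)
qed

section \<open>Hardy spaces on a homogeneous tree\<close>

text \<open>Since \<open>ennreal\<close> truncates negative reals to 0, its additivity on sphere
  means rests on this.\<close>

lemma tree_mean_nonneg: "0 \<le> tree_mean q adj r p n f"
proof -
  have "0 \<le> Max ((\<lambda>v. cmod (f v)) ` shell n)"
    using finite_shell[of n] shell_nonempty[of n] by (subst Max_ge_iff) auto
  then show ?thesis by (auto simp: tree_mean_def)
qed

text \<open>For finite \<open>p\<close>, the pointwise triangle inequality reduces the claim to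
  Minkowski's inequality for the moduli.\<close>

lemma tree_mean_triangle:
  assumes "1 \<le> p"
  shows "tree_mean q adj r p n (\<lambda>v. f v + g v) \<le> tree_mean q adj r p n f + tree_mean q adj r p n g"
proof -
  consider "n = 0" | "n \<noteq> 0" "p = \<infinity>" | "n \<noteq> 0" "p \<noteq> \<infinity>" by blast
  then show ?thesis
  proof cases
    case 1
    then show ?thesis by (simp add: tree_mean_def norm_triangle_ineq)
  next
    case 2
    have "cmod (f v + g v)
        \<le> Max ((\<lambda>v. cmod (f v)) ` shell n) + Max ((\<lambda>v. cmod (g v)) ` shell n)"
      if "v \<in> shell n" for v
      using that finite_shell[of n]
      by (intro order_trans[OF norm_triangle_ineq] add_mono Max_ge) auto
    then show ?thesis
      using 2 finite_shell[of n] shell_nonempty[of n] by (simp add: tree_mean_def)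
  next
    case 3
    define c where "c = 1 / (real (q + 1) * real q ^ (n - 1))"
    define P where "P = enn2real p"
    have P: "1 \<le> P" using enn2real_mono[OF assms] 3 by (simp add: P_def top.not_eq_extremum)
    have "(c * (\<Sum>v\<in>shell n. cmod (f v + g v) powr P)) powr (1 / P)
        \<le> (c * (\<Sum>v\<in>shell n. (cmod (f v) + cmod (g v)) powr P)) powr (1 / P)"
      by (intro powr_mono2 mult_left_mono sum_mono norm_triangle_ineq mult_nonneg_nonneg sum_nonneg)
        (use P in \<open>auto simp: c_def\<close>)
    also have "\<dots> \<le> (c * (\<Sum>v\<in>shell n. cmod (f v) powr P)) powr (1 / P)
                  + (c * (\<Sum>v\<in>shell n. cmod (g v) powr P)) powr (1 / P)"
      by (rule Minkowski_inequality_sum) (use P finite_shell in \<open>auto simp: c_def\<close>)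
    finally show ?thesis using 3 by (simp add: tree_mean_def c_def P_def)
  qed
qed

text \<open>For finite \<open>p\<close>, the sphere has at most as many points as its normalising
  factor, so the averaged powers stay below \<open>c powr P\<close>. The bound is uniform in
  \<open>n\<close>, hence passes to the norm.\<close>

lemma tree_mean_le:
  assumes p: "1 \<le> p" and f: "\<And>v. cmod (f v) \<le> c"
  shows "tree_mean q adj r p n f \<le> c"
proof -
  have c: "0 \<le> c" using f[of r] norm_ge_zero[of "f r"] by linarith
  consider "n = 0" | "n \<noteq> 0" "p = \<infinity>" | m where "n = Suc m" "p \<noteq> \<infinity>"
    by (cases n) auto
  then show ?thesis
  proof cases
    case 1
    then show ?thesis by (simp add: tree_mean_def f)
  next
    case 2
    then show ?thesis
      using f finite_shell[of n] shell_nonempty[of n] by (simp add: tree_mean_def)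
  next
    case 3
    define W where "W = real (q + 1) * real q ^ m"
    define P where "P = enn2real p"
    have P: "1 \<le> P" using enn2real_mono[OF p] 3 by (simp add: P_def top.not_eq_extremum)
    have W: "0 < W" using q by (simp add: W_def)
    have card_le: "real (card (shell n)) \<le> W"
      using card_shell_Suc_le[of m] 3 unfolding W_def by (metis of_nat_le_iff of_nat_mult of_nat_power)
    have "(\<Sum>v\<in>shell n. cmod (f v) powr P) \<le> real (card (shell n)) * c powr P"
      using sum_bounded_above[of "shell n" "\<lambda>v. cmod (f v) powr P" "c powr P"] P f
      by (simp add: powr_mono2)
    also have "\<dots> \<le> W * c powr P" using card_le by (simp add: mult_right_mono)
    finally have "1 / W * (\<Sum>v\<in>shell n. cmod (f v) powr P) \<le> c powr P"
      using W by (simp add: field_simps)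
    then have "(1 / W * (\<Sum>v\<in>shell n. cmod (f v) powr P)) powr (1 / P) \<le> (c powr P) powr (1 / P)"
      using P W by (intro powr_mono2) (auto intro!: divide_nonneg_pos sum_nonneg)
    also have "\<dots> = c" using c P by (simp add: powr_powr)
    finally show ?thesis using 3 by (simp add: tree_mean_def W_def P_def)
  qed
qed

text \<open>For finite \<open>p\<close>, a single term is at most the whole sum, and undoing the
  normalisation costs the factor \<open>W powr (1 / P)\<close>. The constant depends on
  \<open>v\<close> but not on \<open>f\<close>.\<close>

lemma pointwise_le_tree_mean:
  assumes p: "1 \<le> p"
  shows "\<exists>C\<ge>0. \<forall>f. cmod (f v) \<le> C * tree_mean q adj r p (level v) f"
proof -
  define n where "n = level v"
  have v: "v \<in> shell n" by (simp add: tree_sphere_def n_def)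
  consider "n = 0" | "n \<noteq> 0" "p = \<infinity>" | m where "n = Suc m" "p \<noteq> \<infinity>"
    by (cases n) auto
  then show ?thesis
  proof cases
    case 1
    then have "v = r" by (simp add: n_def level_eq_0_iff)
    then show ?thesis by (intro exI[of _ 1]) (simp add: tree_mean_def level_eq_0_iff[THEN iffD2])
  next
    case 2
    then show ?thesis
      using finite_shell[of n] v by (intro exI[of _ 1]) (auto simp: tree_mean_def n_def)
  next
    case 3
    define W where "W = real (q + 1) * real q ^ m"
    define P where "P = enn2real p"
    have P: "1 \<le> P" using enn2real_mono[OF p] 3 by (simp add: P_def top.not_eq_extremum)
    have W: "0 < W" using q by (simp add: W_def)
    have "cmod (f v) \<le> W powr (1 / P) * tree_mean q adj r p n f" for f
    proof -
      have "cmod (f v) powr P \<le> (\<Sum>v\<in>shell n. cmod (f v) powr P)"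
        using v finite_shell by (intro member_le_sum) auto
      also have "\<dots> = W * (1 / W * (\<Sum>v\<in>shell n. cmod (f v) powr P))" using W by simp
      finally have "(cmod (f v) powr P) powr (1 / P)
          \<le> (W * (1 / W * (\<Sum>v\<in>shell n. cmod (f v) powr P))) powr (1 / P)"
        using P by (intro powr_mono2) auto
      also have "\<dots> = W powr (1 / P) * (1 / W * (\<Sum>v\<in>shell n. cmod (f v) powr P)) powr (1 / P)"
        by (rule powr_mult)
      also have "\<dots> = W powr (1 / P) * tree_mean q adj r p n f"
        using 3 by (simp add: tree_mean_def W_def P_def)
      finally show ?thesis using P by (simp add: powr_powr)
    qed
    then show ?thesis unfolding n_def by (intro exI[of _ "W powr (1 / P)"]) auto
  qed
qed

text \<open>The norm sees only moduli. This disposes of signs, both in the symmetry of the distance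
  and in bounding the norm of a difference.\<close>

lemma hardy_norm_cong:
  assumes "\<And>v. cmod (f v) = cmod (g v)"
  shows "hardy_norm q adj r p f = hardy_norm q adj r p g"
  by (simp add: assms hardy_norm_def tree_mean_def cong: if_cong)

lemma hardy_norm_triangle:
  assumes "1 \<le> p"
  shows "hardy_norm q adj r p (\<lambda>v. f v + g v) \<le> hardy_norm q adj r p f + hardy_norm q adj r p g"
  unfolding hardy_norm_def
proof (rule SUP_least)
  fix n
  have "ennreal (tree_mean q adj r p n (\<lambda>v. f v + g v))
      \<le> ennreal (tree_mean q adj r p n f) + ennreal (tree_mean q adj r p n g)"
    using tree_mean_triangle[OF assms] tree_mean_nonneg
    by (simp add: ennreal_plus[symmetric] del: ennreal_plus)
  also have "\<dots> \<le> (SUP n. ennreal (tree_mean q adj r p n f)) + (SUP n. ennreal (tree_mean q adj r p n g))"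
    by (intro add_mono SUP_upper) auto
  finally show "ennreal (tree_mean q adj r p n (\<lambda>v. f v + g v)) \<le> \<dots>" .
qed

lemma hardy_norm_le:
  assumes "1 \<le> p" "\<And>v. cmod (f v) \<le> c"
  shows "hardy_norm q adj r p f \<le> ennreal c"
  unfolding hardy_norm_def by (intro SUP_least ennreal_leI tree_mean_le assms)

lemma bounded_in_hardy_space:
  assumes "1 \<le> p" "\<And>v. cmod (f v) \<le> c"
  shows "f \<in> hardy_space q adj r p"
  using order.strict_trans1[OF hardy_norm_le[OF assms]] by (simp add: hardy_space_def)

lemma pointwise_le_hardy_norm:
  assumes "1 \<le> p"
  shows "\<exists>C\<ge>0. \<forall>f. ennreal (cmod (f v)) \<le> ennreal C * hardy_norm q adj r p f"
proof -
  obtain C where C: "C \<ge> 0" "\<And>f. cmod (f v) \<le> C * tree_mean q adj r p (level v) f"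
    using pointwise_le_tree_mean[OF assms] by blast
  have "ennreal (cmod (f v)) \<le> ennreal C * hardy_norm q adj r p f" for f
  proof -
    have "ennreal (cmod (f v)) \<le> ennreal C * ennreal (tree_mean q adj r p (level v) f)"
      using ennreal_leI[OF C(2)[of f]] C(1) by (simp add: ennreal_mult')
    also have "\<dots> \<le> ennreal C * hardy_norm q adj r p f"
      unfolding hardy_norm_def by (intro mult_left_mono SUP_upper) auto
    finally show ?thesis .
  qed
  then show ?thesis using C(1) by blast
qed

text \<open>The maximum of finitely many evaluation constants serves all of \<open>B\<close>; it
  later becomes the common radius of a polydisc.\<close>

lemma finite_pointwise_le_hardy_norm:
  assumes "1 \<le> p" "finite B"
  shows "\<exists>C\<ge>0. \<forall>v\<in>B. \<forall>f. ennreal (cmod (f v)) \<le> ennreal C * hardy_norm q adj r p f"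
  using assms(2)
proof (induction B)
  case empty
  then show ?case by auto
next
  case (insert w B)
  obtain C where C: "C \<ge> 0" "\<forall>v\<in>B. \<forall>f. ennreal (cmod (f v)) \<le> ennreal C * hardy_norm q adj r p f"
    using insert.IH by blast
  obtain D where D: "D \<ge> 0" "\<forall>f. ennreal (cmod (f w)) \<le> ennreal D * hardy_norm q adj r p f"
    using pointwise_le_hardy_norm[OF assms(1)] by blast
  have "ennreal x \<le> ennreal (max C D) * y" if "ennreal x \<le> ennreal C * y \<or> ennreal x \<le> ennreal D * y" for x y
  proof -
    have "ennreal C * y \<le> ennreal (max C D) * y" "ennreal D * y \<le> ennreal (max C D) * y"
      by (auto intro!: mult_right_mono ennreal_leI)
    then show ?thesis using that order_trans by blast
  qed
  then show ?case using C D by (intro exI[of _ "max C D"]) auto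
qed

section \<open>The metric induced by the norm\<close>

lemma Metric_space_hardy:
  assumes "1 \<le> p"
  shows "Metric_space (hardy_space q adj r p) (\<lambda>f g. enn2real (hardy_norm q adj r p (\<lambda>v. f v - g v)))"
    (is "Metric_space ?X ?d")
proof
  let ?N = "hardy_norm q adj r p"
  have tri: "?N (\<lambda>v. f v - h v) \<le> ?N (\<lambda>v. f v - g v) + ?N (\<lambda>v. g v - h v)" for f g h
    using hardy_norm_triangle[OF assms, of "\<lambda>v. f v - g v" "\<lambda>v. g v - h v"] by simp
  \<comment> \<open>Since \<open>enn2real\<close> sends \<open>top\<close> to 0, finiteness is what
    lets separation and the triangle inequality pass from \<open>ennreal\<close> to the
    reals.\<close>
  have fin: "?N (\<lambda>v. f v - g v) < top" if "f \<in> ?X" "g \<in> ?X" for f g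
  proof -
    have "?N (\<lambda>v. - g v) = ?N g" by (rule hardy_norm_cong) simp
    then have "?N (\<lambda>v. f v - g v) \<le> ?N f + ?N g"
      using hardy_norm_triangle[OF assms, of f "\<lambda>v. - g v"] by simp
    also have "\<dots> < top" using that by (simp add: hardy_space_def)
    finally show ?thesis .
  qed
  fix f g h
  show "0 \<le> ?d f g" by simp
  show "?d f g = ?d g f"
    by (intro arg_cong[where f = enn2real] hardy_norm_cong norm_minus_commute)
  show "?d f g = 0 \<longleftrightarrow> f = g" if "f \<in> ?X" "g \<in> ?X"
  proof
    assume "?d f g = 0"
    then have "?N (\<lambda>v. f v - g v) = 0" using fin[OF that] by (auto simp: enn2real_eq_0_iff)
    \<comment> \<open>Evaluations are dominated by the norm, so norm 0 forces every value of the
      difference to be 0.\<close>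
    moreover have "\<exists>C. \<forall>h. ennreal (cmod (h v)) \<le> ennreal C * ?N h" for v
      using pointwise_le_hardy_norm[OF assms] by blast
    ultimately have "ennreal (cmod (f v - g v)) \<le> 0" for v by (metis mult_zero_right)
    then show "f = g" by (simp add: fun_eq_iff)
  next
    assume "f = g"
    have "?N (\<lambda>v. 0) \<le> ennreal 0" by (rule hardy_norm_le[OF assms]) simp
    then show "?d f g = 0" using \<open>f = g\<close> by simp
  qed
  show "?d f h \<le> ?d f g + ?d g h" if "f \<in> ?X" "g \<in> ?X" "h \<in> ?X"
    using enn2real_mono[OF tri[of f h g]] fin that by (simp add: enn2real_plus)
qed

section \<open>Compactness of the composition operator\<close>

lemma composition_op_compact:
  assumes p: "1 \<le> p" and \<phi>: "bounded_self_map adj r \<phi>"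
  shows "compact_operator_on (hardy_space q adj r p) (hardy_norm q adj r p) (composition_op \<phi>)"
proof -
  let ?X = "hardy_space q adj r p" and ?N = "hardy_norm q adj r p"
  let ?d = "\<lambda>f g. enn2real (?N (\<lambda>v. f v - g v))"
  interpret H: Metric_space ?X ?d by (rule Metric_space_hardy[OF p])
  obtain m where m: "\<And>v. level (\<phi> v) \<le> m"
    using \<phi> by (auto simp: bounded_self_map_def bdd_above_def)
  define B where "B = {v. level v \<le> m}"
  have B: "finite B" "\<And>v. \<phi> v \<in> B" using finite_ball m by (auto simp: B_def)
  obtain C where C: "C \<ge> 0" "\<And>v f. v \<in> B \<Longrightarrow> ennreal (cmod (f v)) \<le> ennreal C * ?N f"
    using finite_pointwise_le_hardy_norm[OF p B(1)] by blast
  \<comment> \<open>All values of \<open>f \<circ> \<phi>\<close> are values of \<open>f\<close> on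
    \<open>B\<close>, so a uniform bound there bounds every sphere mean by the same
    constant.\<close>
  have norm_le: "?N (f \<circ> \<phi>) \<le> ennreal C * ?N f" if "f \<in> ?X" for f
  proof -
    have fin: "ennreal C * ?N f = ennreal (C * enn2real (?N f))"
      using that C(1) by (simp add: hardy_space_def ennreal_mult)
    have "cmod ((f \<circ> \<phi>) v) \<le> C * enn2real (?N f)" for v
      using C(2)[OF B(2), of f v] C(1) unfolding fin by (simp add: ennreal_le_iff)
    then show ?thesis unfolding fin by (rule hardy_norm_le[OF p])
  qed
  have "composition_op \<phi> \<in> ?X \<rightarrow> ?X"
    using norm_le
    by (fastforce simp: hardy_space_def composition_op_def ennreal_mult_less_top
        intro: order.strict_trans1)
  then have bounded: "bounded_linear_operator_on ?X ?N (composition_op \<phi>)"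
    using norm_le by (auto simp: bounded_linear_operator_on_def composition_op_def o_def)

  \<comment> \<open>\<open>K\<close> is the polydisc that contains the restrictions to
    \<open>B\<close> of the unit ball. Its members are \<open>undefined\<close> off
    \<open>B\<close>, where \<open>\<Phi>\<close> never reads them because \<open>\<phi>\<close>
    maps into \<open>B\<close>.\<close>
  define K where "K = PiE B (\<lambda>_. cball (0::complex) C)"
  define \<Phi> where "\<Phi> g = (\<lambda>v. g (\<phi> v))" for g :: "'v \<Rightarrow> complex"
  let ?Y = "product_topology (\<lambda>_. euclidean) B :: ('v \<Rightarrow> complex) topology"
  have \<Phi>_X: "\<Phi> g \<in> ?X" for g
  \<comment> \<open>Only the finitely many values of \<open>g\<close> on \<open>B\<close> occur in
    \<open>\<Phi> g\<close>, so the sum of their moduli is a uniform bound.\<close>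
  proof (rule bounded_in_hardy_space[OF p])
    show "cmod (\<Phi> g v) \<le> (\<Sum>w\<in>B. cmod (g w))" for v
      unfolding \<Phi>_def using B by (intro member_le_sum) auto
  qed
  have cont: "continuous_map ?Y H.mtopology \<Phi>"
    unfolding H.continuous_map_to_metric
  proof (intro ballI allI impI)
    fix g \<epsilon> assume g: "g \<in> topspace ?Y" and \<epsilon>: "(0::real) < \<epsilon>"
    \<comment> \<open>Finiteness of \<open>B\<close> makes this box open. The radius is halved
      because \<open>hardy_norm_le\<close> yields a weak inequality while \<open>H.mball\<close>
      asks for a strict one.\<close>
    let ?U = "PiE B (\<lambda>v. ball (g v) (\<epsilon> / 2))"
    have "openin ?Y ?U" using B(1) by (simp add: openin_PiE_gen)
    moreover have "g \<in> ?U" using g \<epsilon> by (auto simp: PiE_iff)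
    moreover have "\<Phi> h \<in> H.mball (\<Phi> g) \<epsilon>" if "h \<in> ?U" for h
    proof -
      have "?N (\<lambda>v. \<Phi> g v - \<Phi> h v) \<le> ennreal (\<epsilon> / 2)"
        using that B(2) by (intro hardy_norm_le[OF p]) (auto simp: \<Phi>_def PiE_iff dist_norm intro: less_imp_le)
      then have "?d (\<Phi> g) (\<Phi> h) \<le> \<epsilon> / 2" using \<epsilon> by (intro enn2real_leI) auto
      then show ?thesis using \<epsilon> \<Phi>_X by simp
    qed
    ultimately show "\<exists>U. openin ?Y U \<and> g \<in> U \<and> (\<forall>h\<in>U. \<Phi> h \<in> H.mball (\<Phi> g) \<epsilon>)" by blast
  qed
  have "compactin ?Y K" unfolding K_def by (auto simp: compactin_PiE)
  then have compact: "compactin H.mtopology (\<Phi> ` K)" by (rule image_compactin[OF _ cont])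
  then have closed: "closedin H.mtopology (\<Phi> ` K)"
    using H.Hausdorff_space_mtopology by (rule compactin_imp_closedin[rotated])
  have "composition_op \<phi> ` {f \<in> ?X. ?N f \<le> 1} \<subseteq> \<Phi> ` K"
  proof clarify
    fix f assume f: "?N f \<le> 1"
    have "cmod (f v) \<le> C" if "v \<in> B" for v
    proof -
      have "ennreal (cmod (f v)) \<le> ennreal C * 1"
        using C(2)[OF that, of f] f by (metis order_trans mult_left_mono zero_le)
      then show ?thesis using C(1) by simp
    qed
    \<comment> \<open>Passing to the restriction puts \<open>f\<close> into the product space
      without changing its composition with \<open>\<phi>\<close>.\<close>
    then have "restrict f B \<in> K" by (auto simp: K_def)
    moreover have "composition_op \<phi> f = \<Phi> (restrict f B)"
      using B(2) by (auto simp: composition_op_def \<Phi>_def)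
    ultimately show "composition_op \<phi> f \<in> \<Phi> ` K" by blast
  qed
  then have "H.mtopology closure_of (composition_op \<phi> ` {f \<in> ?X. ?N f \<le> 1}) \<subseteq> \<Phi> ` K"
    by (rule closure_of_minimal[OF _ closed])
  then have "compactin H.mtopology (H.mtopology closure_of (composition_op \<phi> ` {f \<in> ?X. ?N f \<le> 1}))"
    by (rule closed_compactin[OF compact]) simp
  then show ?thesis using bounded by (simp add: compact_operator_on_def norm_topology_def)
qed

end

theorem theorem6:
  fixes q :: nat and adj :: "'v \<Rightarrow> 'v \<Rightarrow> bool" and r :: 'v
    and p :: ennreal and \<phi> :: "'v \<Rightarrow> 'v"
  assumes "q \<ge> 1"
    and "homogeneous_tree (q + 1) adj"
    and "1 \<le> p"
    and "bounded_self_map adj r \<phi>"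
  shows "compact_operator_on (hardy_space q adj r p) (hardy_norm q adj r p) (composition_op \<phi>)"
proof -
  interpret rooted_homogeneous_tree q adj r
    using assms(1,2) by unfold_locales
  show ?thesis using assms(3,4) by (rule composition_op_compact)
qed

end
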